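(* Let $\mathsf G$ be the zero-sum stochastic game with asymmetric information, $\mathsf G_v$ the associated virtual game and $\mathsf G_e$ the associated expanded virtual game (all defined in the context). For each of these games let $S^u(\cdot)$ and $S^l(\cdot)$ denote its upper and lower value. Then $$S^l(\mathsf G)=S^l(\mathsf G_v)\le S^l(\mathsf G_e)\le S^u(\mathsf G_e)\le S^u(\mathsf G_v)=S^u(\mathsf G).$$ Consequently, if a Nash equilibrium exists in $\mathsf G$, then the value $S(\mathsf G)$ of $\mathsf G$ satisfies $S(\mathsf G)=S^l(\mathsf G_e)=S^u(\mathsf G_e)$.
   Context: **Notation.** $\Delta\mathcal A$ is the probability simplex over a finite set $\mathcal A$. $X_{a:b}=(X_a,\dots,X_b)$, $X^{1:2}=(X^1,X^2)$. **Game $\mathsf G$.** Fix a horizon $T$ and finite sets $\mathcal X_t$ (states), $\mathcal U_t^i$ (actions), $\mathcal Y_t^i$ (observations), $i=1,2$. The state evolves as $X_{t+1}=f_t(X_t,U_t^1,U_t^2,W_t^s)$ and the observations are $Y_t^i=h_t^i(X_t,U_{t-1}^1,U_{t-1}^2,W_t^i)$, $i=1,2$ (no action arguments at $t=1$). The primitive random variables $X_1,W_t^s,W_t^i$ take finitely many values and are mutually independent. Player $i$'s information at time $t$ is a collection of variables $I_t^i\subseteq\{Y^{1:2}_{1:t},U^{1:2}_{1:t-1}\}$, decomposed as $I_t^i=C_t\cup P_t^i$, where $C_t$ (common information) is known to both players and $P_t^i$ (private information) is known only to player $i$; $\mathcal I_t^i,\mathcal C_t,\mathcal P_t^i$ denote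 the (finite) sets of realizations. Standing assumption: $C_t\subset C_{t+1}$, the increment $Z_{t+1}:=C_{t+1}\setminus C_t$ satisfies $Z_{t+1}=\zeta_{t+1}(P_t^{1:2},U_t^{1:2},Y_{t+1}^{1:2})$, and $P_{t+1}^i=\xi_{t+1}^i(P_t^i,U_t^i,Y_{t+1}^i)$, for fixed functions $\zeta_{t+1},\xi_{t+1}^i$. Player $i$ uses control laws $g_t^i:\mathcal I_t^i\to\Delta\mathcal U_t^i$ and its action is $U_t^i=\kappa(g_t^i(I_t^i),K_t^i)$, where $K^1_{1:T},K^2_{1:T}$ are i.i.d. uniform on $(0,1]$, independent of each other and of the primitive random variables, and $\kappa(\delta,K)$ has distribution $\delta$ when $K$ is uniform on $(0,1]$. The strategy is $g^i=(g_1^i,\dots,g_T^i)$, and $\mathcal G^i$ is the set of all strategies of player $i$. The cost is $J(g^1,g^2)=\mathbb E^{(g^1,g^2)}[\sum_{t=1}^Tc_t(X_t,U_t^1,U_t^2)]$ with $c_t:\mathcal X_t\times\mathcal U_t^1\times\mathcal U_t^2\to\mathbb R$; player 1 minimizes, player 2 maximizes. **Virtual game $\mathsf G_v$.** Same primitive random variables, variables $K_t^i$, system equations and cost functions, but at time $t$ virtual player $i$ selects a prescription $\Gamma_t^i\in\mathcal B_t^i:=\{\text{maps }\mathcal P_t^i\to\Delta\mathcal U_t^i\}$ as $\Gamma_t^i=\chi_t^i(C_t)$, and then $U_t^i=\kappa(\Gamma_t^i(P_t^i),K_t^i)$. $\mathcal H^i$ is the set of all strategies $\chi^i=(\chi_1^i,\dots,\chi_T^i)$.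 The cost is $\mathcal J(\chi^1,\chi^2)=\mathbb E^{(\chi^1,\chi^2)}[\sum_{t=1}^Tc_t(X_t,U_t^1,U_t^2)]$. **Expanded virtual game $\mathsf G_e$.** Same as $\mathsf G_v$, except that virtual player $i$ selects $\Gamma_t^i=\tilde\chi_t^i(C_t,\Gamma_{1:t-1}^{1:2})$, i.e. it also sees all past prescriptions of both players. $\tilde{\mathcal H}^i$ is the set of all strategies $\tilde\chi^i=(\tilde\chi^i_1,\dots,\tilde\chi_T^i)$, and the cost is $\mathcal J(\tilde\chi^1,\tilde\chi^2)=\mathbb E^{(\tilde\chi^1,\tilde\chi^2)}[\sum_{t=1}^Tc_t(X_t,U_t^1,U_t^2)]$. **Values.** The upper value of a game is $\inf$ over player 1's strategies of $\sup$ over player 2's strategies of the cost; the lower value is $\sup$ over player 2's strategies of $\inf$ over player 1's strategies. If equal, the common number is the value $S(\cdot)$. A Nash equilibrium of $\mathsf G$ is $(g^{1*},g^{2*})$ with $J(g^{1*},g^2)\le J(g^{1*},g^{2*})\le J(g^1,g^{2*})$ for all $g^1\in\mathcal G^1,g^2\in\mathcal G^2$. *)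

theory Defs
  imports "HOL-Probability.Probability"
begin

section \<open>Game data\<close>

datatype player = P1 | P2

text \<open>
  Information is a set of variables, each of them an observation or an action of one of the
  players at some time; a realization of a set \<open>V\<close> of variables is an extensional function on \<open>V\<close>.
\<close>

datatype var = Obs player nat | Act player nat

type_synonym ('y, 'u) realization = "var \<Rightarrow> 'y + 'u"

text \<open>A prescription; it is meant for realizations of the private information.\<close>

type_synonym ('y, 'u) prescription = "('y, 'u) realization \<Rightarrow> 'u pmf"

text \<open>
  Times are \<open>1, \<dots>, horizon\<close>. The type \<open>'x\<close> carries all state spaces, \<open>'y\<close> all observation
  spaces, \<open>'u\<close> all action spaces; \<open>'s\<close> and \<open>'w\<close> carry the state and the observation noises.
  The noise spaces are the ranges of the noise variables. Since the observation at time 1 has no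
  action arguments, it has its own function \<open>obs_fun1\<close>; \<open>obs_fun t\<close> is for \<open>t \<ge> 2\<close>.
\<close>

record ('o, 'x, 'y, 'u, 's, 'w) game =
  horizon :: nat
  Omega :: "'o measure"
  States :: "nat \<Rightarrow> 'x set"
  Actions :: "nat \<Rightarrow> player \<Rightarrow> 'u set"
  Observations :: "nat \<Rightarrow> player \<Rightarrow> 'y set"
  init :: "'o \<Rightarrow> 'x"
  state_noise :: "nat \<Rightarrow> 'o \<Rightarrow> 's"
  obs_noise :: "nat \<Rightarrow> player \<Rightarrow> 'o \<Rightarrow> 'w"
  rand :: "nat \<Rightarrow> player \<Rightarrow> 'o \<Rightarrow> real"
  dyn :: "nat \<Rightarrow> 'x \<Rightarrow> 'u \<Rightarrow> 'u \<Rightarrow> 's \<Rightarrow> 'x"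
  obs_fun1 :: "player \<Rightarrow> 'x \<Rightarrow> 'w \<Rightarrow> 'y"
  obs_fun :: "nat \<Rightarrow> player \<Rightarrow> 'x \<Rightarrow> 'u \<Rightarrow> 'u \<Rightarrow> 'w \<Rightarrow> 'y"
  info :: "nat \<Rightarrow> player \<Rightarrow> var set"
  zeta :: "nat \<Rightarrow> (player \<Rightarrow> ('y, 'u) realization) \<Rightarrow> (player \<Rightarrow> 'u) \<Rightarrow> (player \<Rightarrow> 'y)
    \<Rightarrow> ('y, 'u) realization"
  xi :: "nat \<Rightarrow> player \<Rightarrow> ('y, 'u) realization \<Rightarrow> 'u \<Rightarrow> 'y \<Rightarrow> ('y, 'u) realization"
  kappa :: "nat \<Rightarrow> player \<Rightarrow> 'u pmf \<Rightarrow> real \<Rightarrow> 'u"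
  stage_cost :: "nat \<Rightarrow> 'x \<Rightarrow> 'u \<Rightarrow> 'u \<Rightarrow> real"

definition common_info :: "('o, 'x, 'y, 'u, 's, 'w) game \<Rightarrow> nat \<Rightarrow> var set" where
  "common_info G t = info G t P1 \<inter> info G t P2"

definition private_info :: "('o, 'x, 'y, 'u, 's, 'w) game \<Rightarrow> nat \<Rightarrow> player \<Rightarrow> var set" where
  "private_info G t i = info G t i - common_info G t"

definition available :: "nat \<Rightarrow> var set" where
  "available t = {Obs j s | j s. s \<in> {1..t}} \<union> {Act j s | j s. s \<in> {1..<t}}"

fun var_range :: "('o, 'x, 'y, 'u, 's, 'w) game \<Rightarrow> var \<Rightarrow> ('y + 'u) set" where
  "var_range G (Obs i t) = Inl ` Observations G t i"
| "var_range G (Act i t) = Inr ` Actions G t i"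

definition realizations ::
  "('o, 'x, 'y, 'u, 's, 'w) game \<Rightarrow> var set \<Rightarrow> ('y, 'u) realization set" where
  "realizations G V = (\<Pi>\<^sub>E v\<in>V. var_range G v)"

definition prob_simplex :: "'u set \<Rightarrow> 'u pmf set" where
  "prob_simplex A = {p. set_pmf p \<subseteq> A}"

section \<open>Trajectories\<close>

text \<open>
  State, observations and values of the variables at the sample point \<open>\<omega>\<close> when the players use
  the actions \<open>u t i\<close>. The value of \<open>state\<close> at time 0 is irrelevant.
\<close>

fun state :: "('o, 'x, 'y, 'u, 's, 'w) game \<Rightarrow> 'o \<Rightarrow> (nat \<Rightarrow> player \<Rightarrow> 'u) \<Rightarrow> nat \<Rightarrow> 'x" where
  "state G \<omega> u 0 = undefined"
| "state G \<omega> u (Suc 0) = init G \<omega>"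
| "state G \<omega> u (Suc (Suc t)) =
     dyn G (Suc t) (state G \<omega> u (Suc t)) (u (Suc t) P1) (u (Suc t) P2)
       (state_noise G (Suc t) \<omega>)"

definition observation ::
  "('o, 'x, 'y, 'u, 's, 'w) game \<Rightarrow> 'o \<Rightarrow> (nat \<Rightarrow> player \<Rightarrow> 'u) \<Rightarrow> nat \<Rightarrow> player \<Rightarrow> 'y" where
  "observation G \<omega> u t i =
    (if t = 1 then obs_fun1 G i (state G \<omega> u 1) (obs_noise G 1 i \<omega>)
     else obs_fun G t i (state G \<omega> u t) (u (t - 1) P1) (u (t - 1) P2) (obs_noise G t i \<omega>))"

fun var_val ::
  "('o, 'x, 'y, 'u, 's, 'w) game \<Rightarrow> 'o \<Rightarrow> (nat \<Rightarrow> player \<Rightarrow> 'u) \<Rightarrow> ('y, 'u) realization" where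
  "var_val G \<omega> u (Obs i t) = Inl (observation G \<omega> u t i)"
| "var_val G \<omega> u (Act i t) = Inr (u t i)"

section \<open>Standing assumptions\<close>

text \<open>Lebesgue measure on \<open>(0, 1]\<close>, which has total mass 1.\<close>

definition unif01 :: "real measure" where
  "unif01 = restrict_space lborel {0<..1}"

text \<open>Names of the random variables that are assumed to be mutually independent.\<close>

datatype rv = Init | State_noise nat | Obs_noise nat player | Rand nat player

definition rvs :: "nat \<Rightarrow> rv set" where
  "rvs T = {Init} \<union> State_noise ` {1..<T} \<union> {Obs_noise t i | t i. t \<in> {1..T}}
    \<union> {Rand t i | t i. t \<in> {1..T}}"

text \<open>
  The events generated by a random variable. The variables have different types, so their
  independence is stated as independence of these families; \<^const>\<open>prob_space.indep_vars\<close>,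
  which needs a common type, unfolds to the same condition.
\<close>

definition preimages :: "'o measure \<Rightarrow> 'b measure \<Rightarrow> ('o \<Rightarrow> 'b) \<Rightarrow> 'o set set" where
  "preimages M N X = {X -` A \<inter> space M | A. A \<in> sets N}"

fun rv_events :: "('o, 'x, 'y, 'u, 's, 'w) game \<Rightarrow> rv \<Rightarrow> 'o set set" where
  "rv_events G Init = preimages (Omega G) (count_space UNIV) (init G)"
| "rv_events G (State_noise t) = preimages (Omega G) (count_space UNIV) (state_noise G t)"
| "rv_events G (Obs_noise t i) = preimages (Omega G) (count_space UNIV) (obs_noise G t i)"
| "rv_events G (Rand t i) = preimages (Omega G) unif01 (rand G t i)"

definition finite_rv :: "'o measure \<Rightarrow> ('o \<Rightarrow> 'b) \<Rightarrow> bool" where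
  "finite_rv M X \<longleftrightarrow> X \<in> M \<rightarrow>\<^sub>M count_space UNIV \<and> finite (X ` space M)"

text \<open>
  The last two assumptions say that the increment of the common information and the next private
  information are given by \<open>zeta\<close> and \<open>xi\<close>, as an identity between variables of the system:
  for all values of the primitive random variables and all actions.
\<close>

locale asymmetric_game = prob_space "Omega G"
  for G :: "('o, 'x, 'y, 'u, 's, 'w) game" +
  assumes horizon: "1 \<le> horizon G"
    and finite_States: "t \<in> {1..horizon G} \<Longrightarrow> finite (States G t)"
    and finite_Actions: "t \<in> {1..horizon G} \<Longrightarrow> finite (Actions G t i)"
    and Actions_nonempty: "t \<in> {1..horizon G} \<Longrightarrow> Actions G t i \<noteq> {}"
    and finite_Observations: "t \<in> {1..horizon G} \<Longrightarrow> finite (Observations G t i)"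
    and init_rv: "finite_rv (Omega G) (init G)"
    and state_noise_rv: "t \<in> {1..<horizon G} \<Longrightarrow> finite_rv (Omega G) (state_noise G t)"
    and obs_noise_rv: "t \<in> {1..horizon G} \<Longrightarrow> finite_rv (Omega G) (obs_noise G t i)"
    and rand_rv: "t \<in> {1..horizon G} \<Longrightarrow> rand G t i \<in> Omega G \<rightarrow>\<^sub>M unif01"
    and rand_uniform: "t \<in> {1..horizon G} \<Longrightarrow> distr (Omega G) unif01 (rand G t i) = unif01"
    and independent: "indep_sets (rv_events G) (rvs (horizon G))"
    and init_States: "\<omega> \<in> space (Omega G) \<Longrightarrow> init G \<omega> \<in> States G 1"
    and dyn_States: "\<lbrakk>t \<in> {1..<horizon G}; x \<in> States G t; u1 \<in> Actions G t P1;
          u2 \<in> Actions G t P2; \<omega> \<in> space (Omega G)\<rbrakk>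
        \<Longrightarrow> dyn G t x u1 u2 (state_noise G t \<omega>) \<in> States G (t + 1)"
    and obs_fun1_Observations: "\<lbrakk>x \<in> States G 1; \<omega> \<in> space (Omega G)\<rbrakk>
        \<Longrightarrow> obs_fun1 G i x (obs_noise G 1 i \<omega>) \<in> Observations G 1 i"
    and obs_fun_Observations: "\<lbrakk>t \<in> {2..horizon G}; x \<in> States G t; u1 \<in> Actions G (t - 1) P1;
          u2 \<in> Actions G (t - 1) P2; \<omega> \<in> space (Omega G)\<rbrakk>
        \<Longrightarrow> obs_fun G t i x u1 u2 (obs_noise G t i \<omega>) \<in> Observations G t i"
    and kappa_Actions: "\<lbrakk>t \<in> {1..horizon G}; p \<in> prob_simplex (Actions G t i); k \<in> {0<..1}\<rbrakk>
        \<Longrightarrow> kappa G t i p k \<in> Actions G t i"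
    and kappa_measurable: "\<lbrakk>t \<in> {1..horizon G}; p \<in> prob_simplex (Actions G t i)\<rbrakk>
        \<Longrightarrow> kappa G t i p \<in> unif01 \<rightarrow>\<^sub>M count_space UNIV"
    and kappa_distr: "\<lbrakk>t \<in> {1..horizon G}; p \<in> prob_simplex (Actions G t i)\<rbrakk>
        \<Longrightarrow> distr unif01 (count_space UNIV) (kappa G t i p) = measure_pmf p"
    and info_available: "t \<in> {1..horizon G} \<Longrightarrow> info G t i \<subseteq> available t"
    and common_mono: "t \<in> {1..<horizon G} \<Longrightarrow> common_info G t \<subseteq> common_info G (t + 1)"
    and zeta_increment: "\<lbrakk>t \<in> {1..<horizon G}; \<omega> \<in> space (Omega G);
          \<And>s j. s \<in> {1..horizon G} \<Longrightarrow> u s j \<in> Actions G s j\<rbrakk>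
        \<Longrightarrow> restrict (var_val G \<omega> u) (common_info G (t + 1) - common_info G t) =
            zeta G (t + 1) (\<lambda>j. restrict (var_val G \<omega> u) (private_info G t j)) (u t)
              (observation G \<omega> u (t + 1))"
    and xi_private: "\<lbrakk>t \<in> {1..<horizon G}; \<omega> \<in> space (Omega G);
          \<And>s j. s \<in> {1..horizon G} \<Longrightarrow> u s j \<in> Actions G s j\<rbrakk>
        \<Longrightarrow> restrict (var_val G \<omega> u) (private_info G (t + 1) i) =
            xi G (t + 1) i (restrict (var_val G \<omega> u) (private_info G t i)) (u t i)
              (observation G \<omega> u (t + 1) i)"

section \<open>Closed loop and expected cost\<close>

text \<open>
  A decision rule \<open>d t i\<close> turns the values of the variables into the distribution used by player
  \<open>i\<close> at time \<open>t\<close>. The rules below only look at variables in \<open>info G t i\<close> (or in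
  \<open>common_info G s\<close> with \<open>s \<le> t\<close>); the actions from time \<open>t\<close> on, which \<open>actions\<close> has not yet
  filled in when it determines the actions at time \<open>t\<close>, are not among them.
\<close>

type_synonym ('y, 'u) decision_rule = "nat \<Rightarrow> player \<Rightarrow> ('y, 'u) realization \<Rightarrow> 'u pmf"

primrec actions ::
  "('o, 'x, 'y, 'u, 's, 'w) game \<Rightarrow> ('y, 'u) decision_rule \<Rightarrow> 'o \<Rightarrow> nat
    \<Rightarrow> (nat \<Rightarrow> player \<Rightarrow> 'u)" where
  "actions G d \<omega> 0 = (\<lambda>_ _. undefined)"
| "actions G d \<omega> (Suc t) =
     (let u = actions G d \<omega> t
      in u(Suc t := \<lambda>i. kappa G (Suc t) i (d (Suc t) i (var_val G \<omega> u)) (rand G (Suc t) i \<omega>)))"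

definition expected_cost ::
  "('o, 'x, 'y, 'u, 's, 'w) game \<Rightarrow> ('y, 'u) decision_rule \<Rightarrow> real" where
  "expected_cost G d =
    (\<integral>\<omega>. (let u = actions G d \<omega> (horizon G)
          in \<Sum>t=1..horizon G. stage_cost G t (state G \<omega> u t) (u t P1) (u t P2)) \<partial>Omega G)"

fun profile :: "'a \<Rightarrow> 'a \<Rightarrow> player \<Rightarrow> 'a" where
  "profile a b P1 = a"
| "profile a b P2 = b"

section \<open>The original game\<close>

type_synonym ('y, 'u) strategy = "nat \<Rightarrow> ('y, 'u) realization \<Rightarrow> 'u pmf"

definition strategies ::
  "('o, 'x, 'y, 'u, 's, 'w) game \<Rightarrow> player \<Rightarrow> ('y, 'u) strategy set" where
  "strategies G i =
    (\<Pi>\<^sub>E t\<in>{1..horizon G}. realizations G (info G t i) \<rightarrow>\<^sub>E prob_simplex (Actions G t i))"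

definition g_rule ::
  "('o, 'x, 'y, 'u, 's, 'w) game \<Rightarrow> (player \<Rightarrow> ('y, 'u) strategy) \<Rightarrow> ('y, 'u) decision_rule" where
  "g_rule G g t i v = g i t (restrict v (info G t i))"

definition cost ::
  "('o, 'x, 'y, 'u, 's, 'w) game \<Rightarrow> ('y, 'u) strategy \<Rightarrow> ('y, 'u) strategy \<Rightarrow> real" where
  "cost G g1 g2 = expected_cost G (g_rule G (profile g1 g2))"

section \<open>The virtual game\<close>

definition prescriptions ::
  "('o, 'x, 'y, 'u, 's, 'w) game \<Rightarrow> nat \<Rightarrow> player \<Rightarrow> ('y, 'u) prescription set" where
  "prescriptions G t i = realizations G (private_info G t i) \<rightarrow>\<^sub>E prob_simplex (Actions G t i)"

type_synonym ('y, 'u) v_strategy = "nat \<Rightarrow> ('y, 'u) realization \<Rightarrow> ('y, 'u) prescription"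

definition v_strategies ::
  "('o, 'x, 'y, 'u, 's, 'w) game \<Rightarrow> player \<Rightarrow> ('y, 'u) v_strategy set" where
  "v_strategies G i =
    (\<Pi>\<^sub>E t\<in>{1..horizon G}. realizations G (common_info G t) \<rightarrow>\<^sub>E prescriptions G t i)"

definition v_rule ::
  "('o, 'x, 'y, 'u, 's, 'w) game \<Rightarrow> (player \<Rightarrow> ('y, 'u) v_strategy) \<Rightarrow> ('y, 'u) decision_rule" where
  "v_rule G \<psi> t i v =
    (let \<gamma> = \<psi> i t (restrict v (common_info G t)) in \<gamma> (restrict v (private_info G t i)))"

definition v_cost ::
  "('o, 'x, 'y, 'u, 's, 'w) game \<Rightarrow> ('y, 'u) v_strategy \<Rightarrow> ('y, 'u) v_strategy \<Rightarrow> real" where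
  "v_cost G \<psi>1 \<psi>2 = expected_cost G (v_rule G (profile \<psi>1 \<psi>2))"

section \<open>The expanded virtual game\<close>

type_synonym ('y, 'u) past = "nat \<Rightarrow> player \<Rightarrow> ('y, 'u) prescription"

definition pasts :: "('o, 'x, 'y, 'u, 's, 'w) game \<Rightarrow> nat \<Rightarrow> ('y, 'u) past set" where
  "pasts G t = (\<Pi>\<^sub>E s\<in>{1..<t}. \<Pi>\<^sub>E j\<in>UNIV. prescriptions G s j)"

type_synonym ('y, 'u) e_strategy =
  "nat \<Rightarrow> ('y, 'u) realization \<times> ('y, 'u) past \<Rightarrow> ('y, 'u) prescription"

definition e_strategies ::
  "('o, 'x, 'y, 'u, 's, 'w) game \<Rightarrow> player \<Rightarrow> ('y, 'u) e_strategy set" where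
  "e_strategies G i =
    (\<Pi>\<^sub>E t\<in>{1..horizon G}. realizations G (common_info G t) \<times> pasts G t \<rightarrow>\<^sub>E prescriptions G t i)"

text \<open>The prescriptions of both players at the times \<open>1, \<dots>, t\<close>.\<close>

primrec e_prescriptions ::
  "('o, 'x, 'y, 'u, 's, 'w) game \<Rightarrow> (player \<Rightarrow> ('y, 'u) e_strategy) \<Rightarrow> ('y, 'u) realization
    \<Rightarrow> nat \<Rightarrow> ('y, 'u) past" where
  "e_prescriptions G \<psi> v 0 = (\<lambda>_. undefined)"
| "e_prescriptions G \<psi> v (Suc t) =
     (let \<gamma> = e_prescriptions G \<psi> v t
      in \<gamma>(Suc t := \<lambda>i. \<psi> i (Suc t) (restrict v (common_info G (Suc t)), \<gamma>)))"

definition e_rule ::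
  "('o, 'x, 'y, 'u, 's, 'w) game \<Rightarrow> (player \<Rightarrow> ('y, 'u) e_strategy) \<Rightarrow> ('y, 'u) decision_rule" where
  "e_rule G \<psi> t i v =
    (let \<gamma> = e_prescriptions G \<psi> v t t i in \<gamma> (restrict v (private_info G t i)))"

definition e_cost ::
  "('o, 'x, 'y, 'u, 's, 'w) game \<Rightarrow> ('y, 'u) e_strategy \<Rightarrow> ('y, 'u) e_strategy \<Rightarrow> real" where
  "e_cost G \<psi>1 \<psi>2 = expected_cost G (e_rule G (profile \<psi>1 \<psi>2))"

section \<open>Values and equilibria\<close>

text \<open>\<open>A\<close> is the strategy set of the minimizer and \<open>B\<close> that of the maximizer.\<close>

definition upper_value :: "'a set \<Rightarrow> 'b set \<Rightarrow> ('a \<Rightarrow> 'b \<Rightarrow> real) \<Rightarrow> ereal" where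
  "upper_value A B J = (INF a\<in>A. SUP b\<in>B. ereal (J a b))"

definition lower_value :: "'a set \<Rightarrow> 'b set \<Rightarrow> ('a \<Rightarrow> 'b \<Rightarrow> real) \<Rightarrow> ereal" where
  "lower_value A B J = (SUP b\<in>B. INF a\<in>A. ereal (J a b))"

definition is_value :: "'a set \<Rightarrow> 'b set \<Rightarrow> ('a \<Rightarrow> 'b \<Rightarrow> real) \<Rightarrow> real \<Rightarrow> bool" where
  "is_value A B J s \<longleftrightarrow> upper_value A B J = ereal s \<and> lower_value A B J = ereal s"

definition nash_equilibrium ::
  "'a set \<Rightarrow> 'b set \<Rightarrow> ('a \<Rightarrow> 'b \<Rightarrow> real) \<Rightarrow> 'a \<Rightarrow> 'b \<Rightarrow> bool" where
  "nash_equilibrium A B J a b \<longleftrightarrow>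
    a \<in> A \<and> b \<in> B \<and> (\<forall>b'\<in>B. J a b' \<le> J a b) \<and> (\<forall>a'\<in>A. J a b \<le> J a' b)"

definition upper_G :: "('o, 'x, 'y, 'u, 's, 'w) game \<Rightarrow> ereal" where
  "upper_G G = upper_value (strategies G P1) (strategies G P2) (cost G)"

definition lower_G :: "('o, 'x, 'y, 'u, 's, 'w) game \<Rightarrow> ereal" where
  "lower_G G = lower_value (strategies G P1) (strategies G P2) (cost G)"

definition upper_Gv :: "('o, 'x, 'y, 'u, 's, 'w) game \<Rightarrow> ereal" where
  "upper_Gv G = upper_value (v_strategies G P1) (v_strategies G P2) (v_cost G)"

definition lower_Gv :: "('o, 'x, 'y, 'u, 's, 'w) game \<Rightarrow> ereal" where
  "lower_Gv G = lower_value (v_strategies G P1) (v_strategies G P2) (v_cost G)"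

definition upper_Ge :: "('o, 'x, 'y, 'u, 's, 'w) game \<Rightarrow> ereal" where
  "upper_Ge G = upper_value (e_strategies G P1) (e_strategies G P2) (e_cost G)"

definition lower_Ge :: "('o, 'x, 'y, 'u, 's, 'w) game \<Rightarrow> ereal" where
  "lower_Ge G = lower_value (e_strategies G P1) (e_strategies G P2) (e_cost G)"

end

theory Submission
  imports Defs
begin

text \<open>
  A behavioural strategy of the original game is a strategy of the virtual game in curried form, so
  the two games have the same values. A virtual strategy is an expanded strategy that ignores the
  past prescriptions. Against such an opponent, expanded strategies give no advantage: when both
  expanded strategies are fixed, the past prescriptions are determined by \<open>C\<^sub>t\<close> because
  \<open>C\<^sub>s \<subseteq> C\<^sub>t\<close> for \<open>s \<le> t\<close>, so they can be reconstructed instead of observed. All these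
  transformations preserve the actions at every sample point.
\<close>

section \<open>Values of abstract games\<close>

text \<open>Weak duality: for any \<open>a\<close> and \<open>b\<close>, the infimum against
  \<open>b\<close> and the supremum against \<open>a\<close> are separated by \<open>J a b\<close>.
  This alone gives the middle inequality of the chain.\<close>

lemma lower_value_le_upper_value: "lower_value A B J \<le> upper_value A B J"
  unfolding lower_value_def upper_value_def
  by (rule SUP_least, rule INF_greatest) (meson INF_lower SUP_upper order_trans)

text \<open>Reindexing along maps of strategies; this is how values are transported from the virtual
  game to the original one.\<close>

lemma upper_value_image: "upper_value (f ` A) (h ` B) J = upper_value A B (\<lambda>a b. J (f a) (h b))"
  by (simp add: upper_value_def image_image)

lemma lower_value_image: "lower_value (f ` A) (h ` B) J = lower_value A B (\<lambda>a b. J (f a) (h b))"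
  by (simp add: lower_value_def image_image)

lemma upper_value_cong:
  assumes "\<And>a b. a \<in> A \<Longrightarrow> b \<in> B \<Longrightarrow> J a b = J' a b"
  shows "upper_value A B J = upper_value A B J'"
  unfolding upper_value_def using assms by (intro INF_cong SUP_cong) auto

lemma lower_value_cong:
  assumes "\<And>a b. a \<in> A \<Longrightarrow> b \<in> B \<Longrightarrow> J a b = J' a b"
  shows "lower_value A B J = lower_value A B J'"
  unfolding lower_value_def using assms by (intro INF_cong SUP_cong) auto

text \<open>A saddle point: \<open>a\<close> caps the upper value at \<open>J a b\<close>,
  \<open>b\<close> keeps the lower value from falling below it, and weak duality closes the
  gap.\<close>

lemma nash_equilibrium_is_value:
  assumes "nash_equilibrium A B J a b"
  shows "is_value A B J (J a b)"
proof -
  from assms have ab: "a \<in> A" "b \<in> B"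
    and max: "\<And>b'. b' \<in> B \<Longrightarrow> J a b' \<le> J a b"
    and min: "\<And>a'. a' \<in> A \<Longrightarrow> J a b \<le> J a' b"
    by (auto simp: nash_equilibrium_def)
  have "upper_value A B J \<le> (SUP b'\<in>B. ereal (J a b'))"
    unfolding upper_value_def by (rule INF_lower) (rule ab)
  also have "\<dots> \<le> ereal (J a b)"
    by (rule SUP_least) (simp add: max)
  finally have upper: "upper_value A B J \<le> ereal (J a b)" .
  have "ereal (J a b) \<le> (INF a'\<in>A. ereal (J a' b))"
    by (rule INF_greatest) (simp add: min)
  also have "\<dots> \<le> lower_value A B J"
    unfolding lower_value_def by (rule SUP_upper) (rule ab)
  finally have lower: "ereal (J a b) \<le> lower_value A B J" .
  show ?thesis
    unfolding is_value_def
    using upper lower lower_value_le_upper_value[of A B J] by (meson order_antisym order_trans)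
qed

section \<open>Realizations and closed loops\<close>

text \<open>Only the variables available at \<open>t\<close> are constrained, because the closed
  loop has not yet filled in the actions from time \<open>t\<close> on when the decision at
  \<open>t\<close> is made.\<close>

definition admissible ::
  "('o, 'x, 'y, 'u, 's, 'w) game \<Rightarrow> nat \<Rightarrow> ('y, 'u) realization \<Rightarrow> bool" where
  "admissible G t v \<longleftrightarrow> (\<forall>x\<in>available t. v x \<in> var_range G x)"

lemma common_subset_info: "common_info G t \<subseteq> info G t i"
  by (cases i) (auto simp: common_info_def)

lemma private_subset_info: "private_info G t i \<subseteq> info G t i"
  by (auto simp: private_info_def)

lemma info_decomposition: "info G t i = common_info G t \<union> private_info G t i"
  using common_subset_info[of G t i] by (auto simp: private_info_def)

lemma restrict_realizations:
  assumes "r \<in> realizations G V" "W \<subseteq> V"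
  shows "restrict r W \<in> realizations G W"
  using assms by (auto simp: realizations_def PiE_iff)

lemma restrict_restrict_subset: "W \<subseteq> V \<Longrightarrow> restrict (restrict v V) W = restrict v W"
  by (simp add: Int_absorb1)

lemma profile_in_all: "a \<in> S P1 \<Longrightarrow> b \<in> S P2 \<Longrightarrow> profile a b i \<in> S i"
  by (cases i) auto

lemma profile_collapse [simp]: "profile (f P1) (f P2) = f"
  by (rule ext) (case_tac x; simp)

context asymmetric_game
begin

section \<open>Closed loops stay in the prescribed state, observation and action spaces\<close>

lemma state_in_States:
  assumes "\<omega> \<in> space (Omega G)"
    and "\<And>s j. s \<in> {1..<t} \<Longrightarrow> u s j \<in> Actions G s j"
    and "t \<in> {1..horizon G}"
  shows "state G \<omega> u t \<in> States G t"
  using assms(2,3)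
proof (induction t)
  case (Suc t)
  show ?case
  proof (cases t)
    case 0
    then show ?thesis using init_States[OF assms(1)] by simp
  next
    case (Suc n)
    then show ?thesis
      using Suc.IH Suc.prems dyn_States[of t "state G \<omega> u t" "u t P1" "u t P2" \<omega>] assms(1)
      by simp
  qed
qed simp

lemma observation_in_Observations:
  assumes "\<omega> \<in> space (Omega G)"
    and "\<And>s j. s \<in> {1..<t} \<Longrightarrow> u s j \<in> Actions G s j"
    and "t \<in> {1..horizon G}"
  shows "observation G \<omega> u t i \<in> Observations G t i"
proof -
  have x: "state G \<omega> u t \<in> States G t"
    using state_in_States assms by blast
  show ?thesis
  proof (cases "t = 1")
    case True
    then show ?thesis
      using obs_fun1_Observations[OF _ assms(1)] x unfolding observation_def by simp
  next
    case False
    then have "t \<in> {2..horizon G}" "t - 1 \<in> {1..<t}" using assms(3) by auto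
    then show ?thesis
      using obs_fun_Observations[OF _ x _ _ assms(1)] assms(2)[of "t - 1"] False
      unfolding observation_def by simp
  qed
qed

lemma var_val_admissible:
  assumes "\<omega> \<in> space (Omega G)"
    and "\<And>s j. s \<in> {1..<t} \<Longrightarrow> u s j \<in> Actions G s j"
    and "t \<in> {1..horizon G}"
  shows "admissible G t (var_val G \<omega> u)"
  unfolding admissible_def available_def
  using assms(2,3)
  by (auto intro!: imageI observation_in_Observations[OF assms(1)])

lemma restrict_info_realizations:
  assumes "t \<in> {1..horizon G}" "admissible G t v"
  shows "restrict v (info G t i) \<in> realizations G (info G t i)"
  using assms info_available[OF assms(1), of i]
  by (auto simp: admissible_def realizations_def)

lemma restrict_common_realizations:
  assumes "t \<in> {1..horizon G}" "admissible G t v"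
  shows "restrict v (common_info G t) \<in> realizations G (common_info G t)"
  \<comment> \<open>Player \<open>P1\<close> is an arbitrary choice: the common information is part
    of either player's information.\<close>
  using restrict_realizations[OF restrict_info_realizations[OF assms] common_subset_info[of G t P1]]
  by (simp add: restrict_restrict_subset common_subset_info del: restrict_restrict)

lemma restrict_private_realizations:
  assumes "t \<in> {1..horizon G}" "admissible G t v"
  shows "restrict v (private_info G t i) \<in> realizations G (private_info G t i)"
  using restrict_realizations[OF restrict_info_realizations[OF assms] private_subset_info]
  by (simp add: restrict_restrict_subset private_subset_info del: restrict_restrict)

lemma common_info_mono:
  assumes "1 \<le> s" "s \<le> t" "t \<le> horizon G"
  shows "common_info G s \<subseteq> common_info G t"
  using assms(2,3)
proof (induction t rule: dec_induct)
  case (step n)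
  then show ?case using common_mono[of n] assms(1) by fastforce
qed simp

lemma actions_in_Actions:
  assumes \<omega>: "\<omega> \<in> space (Omega G)"
    and d: "\<And>t i v. t \<in> {1..horizon G} \<Longrightarrow> admissible G t v \<Longrightarrow>
      d t i v \<in> prob_simplex (Actions G t i)"
    and "t \<le> horizon G" "s \<in> {1..t}"
  shows "actions G d \<omega> t s j \<in> Actions G s j"
  using assms(3,4)
proof (induction t arbitrary: s j)
  case (Suc t)
  show ?case
  proof (cases "s = Suc t")
    case True
    \<comment> \<open>The induction hypothesis makes the actions up to \<open>t\<close> legal, which
      is all that admissibility at \<open>Suc t\<close> depends on.\<close>
    have "admissible G (Suc t) (var_val G \<omega> (actions G d \<omega> t))"
      using Suc by (intro var_val_admissible[OF \<omega>]) auto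
    \<comment> \<open>Measurability into \<open>unif01\<close> forces values in its space
      \<open>{0<..1}\<close> at every sample point, not just almost surely.\<close>
    moreover have "rand G (Suc t) j \<omega> \<in> {0<..1}"
      using measurable_space[OF rand_rv \<omega>, of "Suc t" j] Suc.prems
      by (simp add: unif01_def)
    ultimately show ?thesis
      using True kappa_Actions d Suc.prems by (simp add: Let_def)
  next
    case False
    then show ?thesis using Suc by (simp add: Let_def)
  qed
qed simp

text \<open>By induction on time both rules produce the same actions at every sample point, so the
  integrands agree pointwise. Legality of \<open>d\<close> suffices, since agreement is invoked only
  along the trajectory of \<open>d\<close>. All cost comparisons between the games go through this
  lemma.\<close>

lemma expected_cost_cong:
  assumes d: "\<And>t i v. t \<in> {1..horizon G} \<Longrightarrow> admissible G t v \<Longrightarrow>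
      d t i v \<in> prob_simplex (Actions G t i)"
    and eq: "\<And>t i v. t \<in> {1..horizon G} \<Longrightarrow> admissible G t v \<Longrightarrow> d t i v = d' t i v"
  shows "expected_cost G d = expected_cost G d'"
proof -
  have "actions G d \<omega> t = actions G d' \<omega> t"
    if \<omega>: "\<omega> \<in> space (Omega G)" and "t \<le> horizon G" for \<omega> t
    using that(2)
  proof (induction t)
    case (Suc t)
    have "admissible G (Suc t) (var_val G \<omega> (actions G d \<omega> t))"
      using Suc.prems by (intro var_val_admissible[OF \<omega>] actions_in_Actions[OF \<omega> d]) auto
    then show ?case
      using Suc eq by (simp add: Let_def)
  qed simp
  then show ?thesis
    unfolding expected_cost_def by (intro Bochner_Integration.integral_cong) simp_all
qed

section \<open>The virtual game\<close>

text \<open>Uncurrying. The bounded abstractions make the result extensional, as membership in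
  \<open>strategies\<close> demands.\<close>

definition of_virtual :: "player \<Rightarrow> ('y, 'u) v_strategy \<Rightarrow> ('y, 'u) strategy" where
  "of_virtual i \<phi> = (\<lambda>t\<in>{1..horizon G}. \<lambda>r\<in>realizations G (info G t i).
    \<phi> t (restrict r (common_info G t)) (restrict r (private_info G t i)))"

definition to_virtual :: "player \<Rightarrow> ('y, 'u) strategy \<Rightarrow> ('y, 'u) v_strategy" where
  "to_virtual i g = (\<lambda>t\<in>{1..horizon G}. \<lambda>c\<in>realizations G (common_info G t).
    \<lambda>p\<in>realizations G (private_info G t i). g t (\<lambda>x. if x \<in> common_info G t then c x else p x))"

lemma v_strategies_prescription:
  assumes "\<phi> \<in> v_strategies G i" "t \<in> {1..horizon G}" "c \<in> realizations G (common_info G t)"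
  shows "\<phi> t c \<in> prescriptions G t i"
  using assms unfolding v_strategies_def by (blast dest: PiE_mem)

lemma prescriptions_simplex:
  assumes "\<gamma> \<in> prescriptions G t i" "p \<in> realizations G (private_info G t i)"
  shows "\<gamma> p \<in> prob_simplex (Actions G t i)"
  using assms unfolding prescriptions_def by (rule PiE_mem)

lemma of_virtual_strategies:
  assumes "\<phi> \<in> v_strategies G i"
  shows "of_virtual i \<phi> \<in> strategies G i"
proof -
  have "\<phi> t (restrict r (common_info G t)) (restrict r (private_info G t i))
      \<in> prob_simplex (Actions G t i)"
    if "t \<in> {1..horizon G}" "r \<in> realizations G (info G t i)" for t r
    using that
    by (intro prescriptions_simplex v_strategies_prescription[OF assms]
        restrict_realizations[OF that(2)] common_subset_info private_subset_info)
  then show ?thesis by (auto simp: of_virtual_def strategies_def)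
qed

text \<open>Private information is \<open>info\<close> minus the common part, so the two pieces glue
  without conflict; outside both, extensionality of \<open>p\<close> supplies
  \<open>undefined\<close>.\<close>

lemma merge_realizations:
  assumes "c \<in> realizations G (common_info G t)" "p \<in> realizations G (private_info G t i)"
  shows "(\<lambda>x. if x \<in> common_info G t then c x else p x) \<in> realizations G (info G t i)"
  using assms by (auto simp: realizations_def info_decomposition[of G t i] PiE_iff extensional_def)

lemma to_virtual_v_strategies:
  assumes "g \<in> strategies G i"
  shows "to_virtual i g \<in> v_strategies G i"
proof -
  have "g t r \<in> prob_simplex (Actions G t i)"
    if "t \<in> {1..horizon G}" "r \<in> realizations G (info G t i)" for t r
    using assms that unfolding strategies_def by (blast dest: PiE_mem)
  then show ?thesis
    unfolding to_virtual_def v_strategies_def prescriptions_def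
    by (intro restrict_PiE_iff[THEN iffD2] ballI) (blast intro: merge_realizations)
qed

lemma of_virtual_to_virtual:
  assumes "g \<in> strategies G i"
  shows "of_virtual i (to_virtual i g) = g"
proof (rule PiE_ext[OF of_virtual_strategies[OF to_virtual_v_strategies[OF assms],
        unfolded strategies_def] assms[unfolded strategies_def]])
  fix t assume t: "t \<in> {1..horizon G}"
  have gt: "g t \<in> realizations G (info G t i) \<rightarrow>\<^sub>E prob_simplex (Actions G t i)"
    using assms t unfolding strategies_def by (rule PiE_mem)
  show "of_virtual i (to_virtual i g) t = g t"
  proof
    fix r
    show "of_virtual i (to_virtual i g) t r = g t r"
    proof (cases "r \<in> realizations G (info G t i)")
      case True
      \<comment> \<open>Splitting a realization into its common and private parts and gluing them
        again returns it.\<close>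
      have "(\<lambda>x. if x \<in> common_info G t then restrict r (common_info G t) x
          else restrict r (private_info G t i) x) = r"
        using True by (auto simp: realizations_def info_decomposition[of G t i] PiE_iff
            extensional_def)
      then show ?thesis
        using True t restrict_realizations[OF True common_subset_info]
          restrict_realizations[OF True private_subset_info]
        by (simp add: of_virtual_def to_virtual_def)
    next
      \<comment> \<open>Outside the realizations both sides take the default value
        \<open>undefined\<close>.\<close>
      case False
      then show ?thesis
        using t PiE_arb[OF gt False] by (simp add: of_virtual_def)
    qed
  qed
qed

text \<open>The right inverse \<open>to_virtual\<close> gives surjectivity, which is what the
  reindexing of values calls for.\<close>

lemma of_virtual_image: "of_virtual i ` v_strategies G i = strategies G i"
  by (auto simp: of_virtual_strategies intro!: rev_image_eqI[OF to_virtual_v_strategies]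
      of_virtual_to_virtual[symmetric])

lemma v_rule_simplex:
  assumes "\<And>i. \<phi> i \<in> v_strategies G i" "t \<in> {1..horizon G}" "admissible G t v"
  shows "v_rule G \<phi> t i v \<in> prob_simplex (Actions G t i)"
  unfolding v_rule_def Let_def
  using assms by (intro prescriptions_simplex v_strategies_prescription
      restrict_common_realizations restrict_private_realizations)

text \<open>The decision rules coincide on admissible realizations: restricting to
  \<open>info\<close> first and then to its common and private parts equals restricting
  directly.\<close>

lemma cost_of_virtual:
  assumes "\<phi>1 \<in> v_strategies G P1" "\<phi>2 \<in> v_strategies G P2"
  shows "cost G (of_virtual P1 \<phi>1) (of_virtual P2 \<phi>2) = v_cost G \<phi>1 \<phi>2"
proof -
  define \<phi> where "\<phi> = profile \<phi>1 \<phi>2"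
  have \<phi>: "\<phi> i \<in> v_strategies G i" for i
    unfolding \<phi>_def using assms by (intro profile_in_all)
  have "expected_cost G (v_rule G \<phi>) = expected_cost G (g_rule G (\<lambda>i. of_virtual i (\<phi> i)))"
  proof (rule expected_cost_cong)
    fix t i v assume "t \<in> {1..horizon G}" "admissible G t v"
    then show "v_rule G \<phi> t i v = g_rule G (\<lambda>i. of_virtual i (\<phi> i)) t i v"
      using restrict_info_realizations[of t v i]
      by (simp add: v_rule_def g_rule_def of_virtual_def Let_def restrict_restrict_subset
          common_subset_info private_subset_info del: restrict_restrict)
  qed (rule v_rule_simplex[OF \<phi>])
  moreover have "(\<lambda>i. of_virtual i (\<phi> i)) = profile (of_virtual P1 \<phi>1) (of_virtual P2 \<phi>2)"
    using profile_collapse[of "\<lambda>i. of_virtual i (\<phi> i)"] by (simp add: \<phi>_def)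
  ultimately show ?thesis
    by (simp add: cost_def v_cost_def \<phi>_def)
qed

lemma upper_Gv_eq_upper_G: "upper_Gv G = upper_G G"
  unfolding upper_Gv_def upper_G_def of_virtual_image[symmetric] upper_value_image
  by (rule upper_value_cong) (simp add: cost_of_virtual)

lemma lower_Gv_eq_lower_G: "lower_Gv G = lower_G G"
  unfolding lower_Gv_def lower_G_def of_virtual_image[symmetric] lower_value_image
  by (rule lower_value_cong) (simp add: cost_of_virtual)

section \<open>The expanded virtual game\<close>

definition ignore_past :: "player \<Rightarrow> ('y, 'u) v_strategy \<Rightarrow> ('y, 'u) e_strategy" where
  "ignore_past i \<phi> = (\<lambda>t\<in>{1..horizon G}. \<lambda>(c, \<gamma>)\<in>realizations G (common_info G t) \<times> pasts G t. \<phi> t c)"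

text \<open>The recursion is run on \<open>c\<close> alone, as its first \<open>t\<close> steps read
  only common information contained in that of time \<open>t\<close>. The whole profile is an
  argument because the past prescriptions of both players must be simulated.\<close>

definition reconstruct_past ::
  "(player \<Rightarrow> ('y, 'u) e_strategy) \<Rightarrow> player \<Rightarrow> ('y, 'u) v_strategy" where
  "reconstruct_past \<psi> i = (\<lambda>t\<in>{1..horizon G}. \<lambda>c\<in>realizations G (common_info G t).
    e_prescriptions G \<psi> c t t i)"

lemma ignore_past_e_strategies:
  assumes "\<phi> \<in> v_strategies G i"
  shows "ignore_past i \<phi> \<in> e_strategies G i"
  using v_strategies_prescription[OF assms] by (auto simp: ignore_past_def e_strategies_def)

lemma e_strategies_prescription:
  assumes "\<psi> \<in> e_strategies G i" "t \<in> {1..horizon G}"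
    "c \<in> realizations G (common_info G t)" "\<gamma> \<in> pasts G t"
  shows "\<psi> t (c, \<gamma>) \<in> prescriptions G t i"
  using assms unfolding e_strategies_def by (blast dest: PiE_mem)

text \<open>Legality of the common information at \<open>t\<close> passes to all earlier times by
  inclusion. The index is \<open>Suc s\<close> because \<open>pasts\<close> stops strictly before
  its time argument.\<close>

lemma e_prescriptions_pasts:
  assumes \<psi>: "\<And>i. \<psi> i \<in> e_strategies G i"
    and "restrict v (common_info G t) \<in> realizations G (common_info G t)"
    and "s \<le> t" "t \<le> horizon G"
  shows "e_prescriptions G \<psi> v s \<in> pasts G (Suc s)"
  using assms(3)
proof (induction s)
  case 0
  then show ?case by (simp add: pasts_def)
next
  case (Suc s)
  have sub: "common_info G (Suc s) \<subseteq> common_info G t"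
    using Suc.prems assms(4) by (intro common_info_mono) auto
  have "restrict v (common_info G (Suc s)) \<in> realizations G (common_info G (Suc s))"
    using restrict_realizations[OF assms(2) sub] restrict_restrict_subset[OF sub, of v] by simp
  then have "\<psi> i (Suc s) (restrict v (common_info G (Suc s)), e_prescriptions G \<psi> v s)
      \<in> prescriptions G (Suc s) i" for i
    using Suc assms(4) by (intro e_strategies_prescription[OF \<psi>]) auto
  then show ?case
    using Suc by (auto simp: pasts_def Let_def PiE_iff extensional_def less_Suc_eq)
qed

lemma e_prescriptions_prescription:
  assumes \<psi>: "\<And>i. \<psi> i \<in> e_strategies G i"
    and "restrict v (common_info G t) \<in> realizations G (common_info G t)"
    and "t \<in> {1..horizon G}"
  shows "e_prescriptions G \<psi> v t t i \<in> prescriptions G t i"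
  using e_prescriptions_pasts[OF assms(1,2), of t] assms(3) by (auto simp: pasts_def PiE_iff)

text \<open>Each of the first \<open>s\<close> steps reads common information of a time at most
  \<open>s\<close>, and all of it survives the restriction. This is where the growth of common
  information lets prescriptions be recomputed rather than observed.\<close>

lemma e_prescriptions_restrict:
  assumes "s \<le> t" "t \<le> horizon G"
  shows "e_prescriptions G \<psi> (restrict v (common_info G t)) s = e_prescriptions G \<psi> v s"
  using assms(1)
proof (induction s)
  case (Suc s)
  then have "common_info G (Suc s) \<subseteq> common_info G t"
    using assms(2) by (intro common_info_mono) auto
  from restrict_restrict_subset[OF this, of v] show ?case
    using Suc by (simp add: Let_def del: restrict_restrict restrict_apply)
qed simp

lemma restrict_realization_self: "c \<in> realizations G V \<Longrightarrow> restrict c V = c"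
  by (simp add: realizations_def PiE_restrict)

lemma reconstruct_past_v_strategies:
  assumes "\<And>i. \<psi> i \<in> e_strategies G i"
  shows "reconstruct_past \<psi> i \<in> v_strategies G i"
  using e_prescriptions_prescription[OF assms]
  by (auto simp: reconstruct_past_def v_strategies_def restrict_realization_self)

text \<open>Reconstruction fixes a player who already ignores the past, so replacing a whole profile
  by its reconstruction alters only the opponent's side.\<close>

lemma reconstruct_past_ignore_past:
  assumes \<psi>: "\<And>j. \<psi> j \<in> e_strategies G j"
    and \<phi>: "\<phi> \<in> v_strategies G i" and eq: "\<psi> i = ignore_past i \<phi>"
  shows "reconstruct_past \<psi> i = \<phi>"
proof (rule PiE_ext[OF reconstruct_past_v_strategies[OF \<psi>, unfolded v_strategies_def]
        \<phi>[unfolded v_strategies_def]])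
  fix t assume t: "t \<in> {1..horizon G}"
  then obtain n where n: "t = Suc n" by (cases t) auto
  have \<phi>t: "\<phi> t \<in> realizations G (common_info G t) \<rightarrow>\<^sub>E prescriptions G t i"
    using \<phi> t unfolding v_strategies_def by (rule PiE_mem)
  show "reconstruct_past \<psi> i t = \<phi> t"
  proof
    fix c
    show "reconstruct_past \<psi> i t c = \<phi> t c"
    proof (cases "c \<in> realizations G (common_info G t)")
      case True
      then have c: "restrict c (common_info G t) = c" by (rule restrict_realization_self)
      \<comment> \<open>The past seen at \<open>t = Suc n\<close> is the output of step
        \<open>n\<close>; its legality is needed because \<open>ignore_past\<close> is
        \<open>undefined\<close> elsewhere.\<close>
      have "e_prescriptions G \<psi> c n \<in> pasts G t"
        using e_prescriptions_pasts[OF \<psi>, of c t n] True c n t by simp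
      then have "e_prescriptions G \<psi> c t t i = \<phi> t c"
        using True c t n by (simp add: Let_def eq ignore_past_def)
      then show ?thesis
        using True t by (simp add: reconstruct_past_def)
    next
      case False
      then show ?thesis
        using t PiE_arb[OF \<phi>t False] by (simp add: reconstruct_past_def)
    qed
  qed
qed

lemma expected_cost_reconstruct_past:
  assumes \<psi>: "\<And>i. \<psi> i \<in> e_strategies G i"
  shows "expected_cost G (v_rule G (reconstruct_past \<psi>)) = expected_cost G (e_rule G \<psi>)"
proof (rule expected_cost_cong)
  fix t i v assume "t \<in> {1..horizon G}" "admissible G t v"
  then show "v_rule G (reconstruct_past \<psi>) t i v = e_rule G \<psi> t i v"
    using restrict_common_realizations[of t v]
    by (simp add: v_rule_def e_rule_def reconstruct_past_def Let_def e_prescriptions_restrict)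
qed (rule v_rule_simplex[OF reconstruct_past_v_strategies[OF \<psi>]])

lemma v_cost_reconstruct_past:
  assumes "\<psi>1 \<in> e_strategies G P1" "\<psi>2 \<in> e_strategies G P2"
  shows "v_cost G (reconstruct_past (profile \<psi>1 \<psi>2) P1) (reconstruct_past (profile \<psi>1 \<psi>2) P2)
    = e_cost G \<psi>1 \<psi>2"
  unfolding v_cost_def e_cost_def profile_collapse
  using assms by (intro expected_cost_reconstruct_past profile_in_all)

section \<open>Comparison of the values of the virtual and the expanded game\<close>

lemma lower_Gv_le_lower_Ge: "lower_Gv G \<le> lower_Ge G"
  unfolding lower_Gv_def lower_Ge_def lower_value_def
proof (rule SUP_mono)
  fix \<phi> assume \<phi>: "\<phi> \<in> v_strategies G P2"
  let ?\<psi>2 = "ignore_past P2 \<phi>"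
  \<comment> \<open>Every expanded reply to the embedded \<open>\<phi>\<close> is matched by a
    virtual reply of equal cost. That reply may depend on \<open>\<phi>\<close>, since the infimum
    is taken with \<open>\<phi>\<close> fixed.\<close>
  have "(INF a\<in>v_strategies G P1. ereal (v_cost G a \<phi>)) \<le> ereal (e_cost G \<psi>1 ?\<psi>2)"
    if \<psi>1: "\<psi>1 \<in> e_strategies G P1" for \<psi>1
  proof -
    let ?\<psi> = "profile \<psi>1 ?\<psi>2"
    have \<psi>: "?\<psi> i \<in> e_strategies G i" for i
      using \<psi>1 ignore_past_e_strategies[OF \<phi>] by (intro profile_in_all)
    have "e_cost G \<psi>1 ?\<psi>2 = v_cost G (reconstruct_past ?\<psi> P1) \<phi>"
      using v_cost_reconstruct_past[OF \<psi>1 ignore_past_e_strategies[OF \<phi>]]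
        reconstruct_past_ignore_past[of ?\<psi> \<phi> P2] \<psi> \<phi> by simp
    then show ?thesis
      using reconstruct_past_v_strategies[of ?\<psi> P1] \<psi> by (auto intro: INF_lower)
  qed
  then show "\<exists>b\<in>e_strategies G P2. (INF a\<in>v_strategies G P1. ereal (v_cost G a \<phi>))
      \<le> (INF a\<in>e_strategies G P1. ereal (e_cost G a b))"
    using ignore_past_e_strategies[OF \<phi>] by (intro bexI[of _ ?\<psi>2] INF_greatest) auto
qed

lemma upper_Ge_le_upper_Gv: "upper_Ge G \<le> upper_Gv G"
  unfolding upper_Gv_def upper_Ge_def upper_value_def
proof (rule INF_mono)
  fix \<phi> assume \<phi>: "\<phi> \<in> v_strategies G P1"
  let ?\<psi>1 = "ignore_past P1 \<phi>"
  \<comment> \<open>The same matching with roles exchanged: the minimizer commits to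
    \<open>\<phi>\<close> and the maximizer's reply is reconstructed.\<close>
  have "ereal (e_cost G ?\<psi>1 \<psi>2) \<le> (SUP b\<in>v_strategies G P2. ereal (v_cost G \<phi> b))"
    if \<psi>2: "\<psi>2 \<in> e_strategies G P2" for \<psi>2
  proof -
    let ?\<psi> = "profile ?\<psi>1 \<psi>2"
    have \<psi>: "?\<psi> i \<in> e_strategies G i" for i
      using \<psi>2 ignore_past_e_strategies[OF \<phi>] by (intro profile_in_all)
    have "e_cost G ?\<psi>1 \<psi>2 = v_cost G \<phi> (reconstruct_past ?\<psi> P2)"
      using v_cost_reconstruct_past[OF ignore_past_e_strategies[OF \<phi>] \<psi>2]
        reconstruct_past_ignore_past[of ?\<psi> \<phi> P1] \<psi> \<phi> by simp
    then show ?thesis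
      using reconstruct_past_v_strategies[of ?\<psi> P2] \<psi> by (auto intro: SUP_upper)
  qed
  then show "\<exists>a\<in>e_strategies G P1. (SUP b\<in>e_strategies G P2. ereal (e_cost G a b))
      \<le> (SUP b\<in>v_strategies G P2. ereal (v_cost G \<phi> b))"
    using ignore_past_e_strategies[OF \<phi>] by (intro bexI[of _ ?\<psi>1] SUP_least) auto
qed

end

theorem theorem1:
  fixes G :: "('o, 'x, 'y, 'u, 's, 'w) game"
  assumes "asymmetric_game G"
  shows "lower_G G = lower_Gv G \<and> lower_Gv G \<le> lower_Ge G \<and> lower_Ge G \<le> upper_Ge G \<and>
      upper_Ge G \<le> upper_Gv G \<and> upper_Gv G = upper_G G \<and>
    ((\<exists>g1 g2. nash_equilibrium (strategies G P1) (strategies G P2) (cost G) g1 g2) \<longrightarrow>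
      (\<exists>s. is_value (strategies G P1) (strategies G P2) (cost G) s \<and>
        ereal s = lower_Ge G \<and> ereal s = upper_Ge G))"
proof -
  interpret asymmetric_game G by (rule assms)
  have chain: "lower_G G = lower_Gv G" "lower_Gv G \<le> lower_Ge G" "lower_Ge G \<le> upper_Ge G"
    "upper_Ge G \<le> upper_Gv G" "upper_Gv G = upper_G G"
    using lower_Gv_eq_lower_G lower_Gv_le_lower_Ge upper_Ge_le_upper_Gv upper_Gv_eq_upper_G
    by (simp_all add: lower_Ge_def upper_Ge_def lower_value_le_upper_value)
  \<comment> \<open>A value of the original game makes both ends of the chain equal to
    \<open>s\<close>, which squeezes everything in between.\<close>
  have "ereal s = lower_Ge G \<and> ereal s = upper_Ge G"
    if "is_value (strategies G P1) (strategies G P2) (cost G) s" for s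
    using that chain unfolding is_value_def lower_G_def upper_G_def
    by (metis order_antisym order_trans)
  then have "\<exists>s. is_value (strategies G P1) (strategies G P2) (cost G) s \<and>
      ereal s = lower_Ge G \<and> ereal s = upper_Ge G"
    if "\<exists>g1 g2. nash_equilibrium (strategies G P1) (strategies G P2) (cost G) g1 g2"
    using that nash_equilibrium_is_value by metis
  with chain show ?thesis
    by (intro conjI impI)
qed

end
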